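(* Let $\mathfrak g$ be a (finite-dimensional) reductive Lie algebra over an algebraically closed field of characteristic zero, let $e\in\mathfrak g$ satisfy $(\operatorname{ad} e)^3=0$, and put $D=(\operatorname{ad} e)^2$. Then the Lie algebra $\mathfrak g_D=(\mathfrak g,[\ ,\,]'_D)$ is $2$-step nilpotent, i.e. $[\mathfrak g_D,\mathfrak g_D]\subset\mathfrak z(\mathfrak g_D)$, where $[\mathfrak g_D,\mathfrak g_D]$ is the derived subalgebra and $\mathfrak z(\mathfrak g_D)$ the centre of $\mathfrak g_D$ (both with respect to the bracket $[\ ,\,]'_D$).
   Context: $[x,y]'_D=D([x,y])-[Dx,y]-[x,Dy]$ is the derived operation of the Lie bracket of $\mathfrak g$ with respect to $D$; under the stated hypotheses it is a Lie bracket on the vector space $\mathfrak g$. *)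

theory Defs
  imports "HOL-Computational_Algebra.Polynomial"
begin

locale lie_algebra = vector_space scale
  for scale :: "'k::field \<Rightarrow> 'g::ab_group_add \<Rightarrow> 'g" (infixr \<open>*s\<close> 75) +
  fixes bracket :: "'g \<Rightarrow> 'g \<Rightarrow> 'g"
  assumes bracket_add_left: "bracket (x + y) z = bracket x z + bracket y z"
    and bracket_add_right: "bracket x (y + z) = bracket x y + bracket x z"
    and bracket_scale_left: "bracket (c *s x) y = c *s bracket x y"
    and bracket_scale_right: "bracket x (c *s y) = c *s bracket x y"
    and bracket_self: "bracket x x = 0"
    and jacobi: "bracket x (bracket y z) + bracket y (bracket z x) + bracket z (bracket x y) = 0"
begin

definition commutator :: "'g set \<Rightarrow> 'g set \<Rightarrow> 'g set" where
  "commutator A B = span {bracket x y | x y. x \<in> A \<and> y \<in> B}"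

definition derived_subalgebra :: "'g set" where
  "derived_subalgebra = commutator UNIV UNIV"

definition lie_centre :: "'g set" where
  "lie_centre = {z. \<forall>x. bracket z x = 0}"

definition lie_ideal :: "'g set \<Rightarrow> bool" where
  "lie_ideal I \<longleftrightarrow> subspace I \<and> (\<forall>x. \<forall>y\<in>I. bracket x y \<in> I)"

primrec derived_series :: "'g set \<Rightarrow> nat \<Rightarrow> 'g set" where
  "derived_series A 0 = A"
| "derived_series A (Suc n) = commutator (derived_series A n) (derived_series A n)"

definition lie_solvable :: "'g set \<Rightarrow> bool" where
  "lie_solvable A \<longleftrightarrow> (\<exists>n. derived_series A n = {0})"

text \<open>The sum of all solvable ideals; in finite dimension this is itself a solvable
  ideal, hence the largest one.\<close>
definition lie_radical :: "'g set" where
  "lie_radical = span (\<Union>{I. lie_ideal I \<and> lie_solvable I})"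

text \<open>Meant for finite-dimensional algebras. In characteristic zero, the condition
  agrees with complete reducibility of the adjoint representation.\<close>
definition reductive :: bool where
  "reductive \<longleftrightarrow> lie_radical = lie_centre"

end

definition ad :: "('g \<Rightarrow> 'g \<Rightarrow> 'g) \<Rightarrow> 'g \<Rightarrow> 'g \<Rightarrow> 'g" where
  "ad bracket x = (\<lambda>y. bracket x y)"

definition derived_operation ::
  "('g::ab_group_add \<Rightarrow> 'g \<Rightarrow> 'g) \<Rightarrow> ('g \<Rightarrow> 'g) \<Rightarrow> 'g \<Rightarrow> 'g \<Rightarrow> 'g" where
  "derived_operation bracket D x y = D (bracket x y) - bracket (D x) y - bracket x (D y)"

end

theory Submission
  imports Defs
begin

text \<open>
  Write \<open>N = ad e\<close>, a derivation of the Lie algebra, so that \<open>D = N\<^sup>2\<close>.  Two uses of the Leibniz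
  rule carry the proof.  Expanding \<open>N\<^sup>2 [x, y]\<close> shows that the derived operation is
  \<open>[x, y]'\<^sub>D = 2 [N x, N y]\<close>.  Expanding \<open>0 = N\<^sup>3 [x, y]\<close>, the two outer terms vanish since
  \<open>N\<^sup>3 = 0\<close>, and what remains is
    \<open>3 ([N\<^sup>2 x, N y] + [N x, N\<^sup>2 y]) = 3 N [N x, N y]\<close>.
  As 3 is invertible, \<open>N\<close> kills every bracket \<open>[N x, N y]\<close>.  Hence
  \<open>[[x, y]'\<^sub>D, z]'\<^sub>D = 4 [N [N x, N y], N z] = 0\<close>.  Each term of the Jacobi identity for the
  derived operation therefore vanishes separately, and all commutators are central, which is
  2-step nilpotency.

  The computation is carried out for an arbitrary derivation \<open>N\<close> of cube zero and specialised to
  \<open>ad e\<close> at the end.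
\<close>

context lie_algebra
begin

lemma bracket_zero_left [simp]: "bracket 0 x = 0"
  using bracket_add_left[of 0 0 x] by simp

lemma bracket_zero_right [simp]: "bracket x 0 = 0"
  using bracket_add_right[of x 0 0] by simp

lemma bracket_minus_right: "bracket x (- y) = - bracket x y"
  using bracket_add_right[of x y "- y"] by (simp add: eq_neg_iff_add_eq_0 add.commute)

lemma bracket_antisym: "bracket x y = - bracket y x"
proof -
  have "bracket y x + bracket x y = 0"
    using bracket_self[of "x + y", unfolded bracket_add_left bracket_add_right]
    by (simp add: bracket_self)
  then show ?thesis
    by (simp add: eq_neg_iff_add_eq_0 add.commute)
qed

text \<open>This is the Jacobi identity, read as a statement about \<open>ad e\<close>.\<close>
lemma ad_leibniz:
  "bracket e (bracket x y) = bracket (bracket e x) y + bracket x (bracket e y)"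
proof -
  have "bracket e (bracket x y) = - bracket x (bracket y e) - bracket y (bracket e x)"
    using jacobi[of e x y] by (simp add: eq_neg_iff_add_eq_0 algebra_simps)
  also have "- bracket x (bracket y e) = bracket x (bracket e y)"
    using bracket_antisym[of y e] by (simp add: bracket_minus_right)
  also have "bracket x (bracket e y) - bracket y (bracket e x) =
      bracket (bracket e x) y + bracket x (bracket e y)"
    using bracket_antisym[of "bracket e x" y] by simp
  finally show ?thesis .
qed

lemma subspace_lie_centre: "subspace lie_centre"
  by (auto simp: subspace_def lie_centre_def bracket_add_left bracket_scale_left)

lemma derived_subalgebra_subset_centre_if_brackets_vanish:
  assumes "\<And>x y z. bracket (bracket x y) z = 0"
  shows "derived_subalgebra \<subseteq> lie_centre"
  unfolding derived_subalgebra_def commutator_def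
  by (rule span_minimal[OF _ subspace_lie_centre]) (auto simp: lie_centre_def assms)

end

locale cube_zero_derivation = lie_algebra scale bracket
  for scale :: "'k::field \<Rightarrow> 'g::ab_group_add \<Rightarrow> 'g" (infixr \<open>*s\<close> 75)
    and bracket :: "'g \<Rightarrow> 'g \<Rightarrow> 'g" +
  fixes N :: "'g \<Rightarrow> 'g"
  assumes N_add: "N (x + y) = N x + N y"
    and N_scale: "N (c *s x) = c *s N x"
    and N_leibniz: "N (bracket x y) = bracket (N x) y + bracket x (N y)"
    and N_cube: "N (N (N x)) = 0"
    and three_neq_0: "(3::'k) \<noteq> 0"
begin

text \<open>The inner binomial coefficients of the third power both equal 3, so the Leibniz expansion of
  \<open>N\<^sup>3 [x, y] = 0\<close> is three times the Leibniz expansion of \<open>N [N x, N y]\<close>.  This is the only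
  point where the characteristic matters.\<close>
lemma N_bracket_of_images: "N (bracket (N x) (N y)) = 0"
proof -
  let ?v = "bracket (N (N x)) (N y) + bracket (N x) (N (N y))"
  have "?v + ?v + ?v = N (N (N (bracket x y)))"
    by (simp add: N_leibniz N_add N_cube algebra_simps)
  then have "3 *s ?v = 0"
    using scale_left_distrib[of 2 1 ?v] scale_left_distrib[of 1 1 ?v]
    by (simp add: N_cube)
  then show ?thesis
    using three_neq_0 by (simp add: N_leibniz)
qed

text \<open>In the Leibniz expansion of the square of a derivation, only the mixed term survives
  subtracting the two pure ones.\<close>
lemma derived_operation_square:
  "derived_operation bracket (N ^^ 2) x y = bracket (N x) (N y) + bracket (N x) (N y)"
  by (simp add: derived_operation_def numeral_2_eq_2 N_leibniz N_add algebra_simps)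

lemma derived_operation_nested_left:
  "derived_operation bracket (N ^^ 2) (derived_operation bracket (N ^^ 2) x y) z = 0"
  by (simp add: derived_operation_square N_add N_bracket_of_images)

lemma derived_operation_nested_right:
  "derived_operation bracket (N ^^ 2) z (derived_operation bracket (N ^^ 2) x y) = 0"
  by (simp add: derived_operation_square N_add N_bracket_of_images)

lemma lie_algebra_derived_operation:
  "lie_algebra scale (derived_operation bracket (N ^^ 2))"
proof unfold_locales
  fix x y z c
  let ?B = "derived_operation bracket (N ^^ 2)"
  show "?B (x + y) z = ?B x z + ?B y z" "?B x (y + z) = ?B x y + ?B x z"
    by (simp_all add: derived_operation_square N_add bracket_add_left bracket_add_right
        algebra_simps)
  show "?B (c *s x) y = c *s ?B x y" "?B x (c *s y) = c *s ?B x y"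
    by (simp_all add: derived_operation_square N_scale bracket_scale_left bracket_scale_right
        scale_right_distrib)
  show "?B x x = 0"
    by (simp add: derived_operation_square bracket_self)
  show "?B x (?B y z) + ?B y (?B z x) + ?B z (?B x y) = 0"
    by (simp add: derived_operation_nested_right)
qed

end

theorem proposition7p8:
  fixes scale :: "'k::{alg_closed_field, field_char_0} \<Rightarrow> 'g::ab_group_add \<Rightarrow> 'g"
    and Basis :: "'g set"
    and bracket :: "'g \<Rightarrow> 'g \<Rightarrow> 'g"
    and e :: 'g
    and D :: "'g \<Rightarrow> 'g"
  assumes "lie_algebra scale bracket"
    and "finite_dimensional_vector_space scale Basis"
    and "lie_algebra.reductive scale bracket"
    and "(ad bracket e ^^ 3) = (\<lambda>_. 0)"
    and "D = ad bracket e ^^ 2"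
  shows "lie_algebra scale (derived_operation bracket D) \<and>
    lie_algebra.derived_subalgebra scale (derived_operation bracket D)
      \<subseteq> lie_algebra.lie_centre (derived_operation bracket D)"
proof -
  interpret lie_algebra scale bracket by fact
  have cube: "bracket e (bracket e (bracket e x)) = 0" for x
    using fun_cong[OF assms(4), of x] by (simp add: numeral_3_eq_3 ad_def)
  interpret cube_zero_derivation scale bracket "ad bracket e"
    by unfold_locales
      (simp_all add: ad_def cube ad_leibniz[symmetric] bracket_add_right bracket_scale_right)
  interpret derived: lie_algebra scale "derived_operation bracket D"
    unfolding assms(5) by (rule lie_algebra_derived_operation)
  have "derived.derived_subalgebra \<subseteq> derived.lie_centre"
    by (rule derived.derived_subalgebra_subset_centre_if_brackets_vanish)
      (simp add: assms(5) derived_operation_nested_left)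
  then show ?thesis
    using derived.lie_algebra_axioms by blast
qed

end
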